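(* Let $G$ be a group with finite generating set $\Sigma$, and let $<$ be a fixed total order on $\Sigma\cup\Sigma^{-1}$. If $G$ satisfies the shortlex falsification by fellow traveller property with respect to $\Sigma$ (and $<$), then the set of shortlex representatives $\mathrm{SL}_G\subset(\Sigma\cup\Sigma^{-1})^*$ is a regular language.
   Context: $\Sigma\cup\Sigma^{-1}$ is regarded as a finite subset of $G$, and $(\Sigma\cup\Sigma^{-1})^*$ is the set of finite words over it; $|w|$ is the length of a word $w$, and $w=_Gv$ means that $w$ and $v$ represent the same element of $G$. Shortlex order. For words $w_1,w_2$ over a totally ordered alphabet $(S,<)$: $w_1<_{\mathrm{lex}}w_2$ iff $w_1$ is a strict prefix of $w_2$ or, in the first position where they differ, the letter of $w_1$ is smaller than that of $w_2$; $w_1<_{\mathrm{SL}}w_2$ iff $|w_1|<|w_2|$, or $|w_1|=|w_2|$ and $w_1<_{\mathrm{lex}}w_2$. The order $<_{\mathrm{SL}}$ is a well-ordering. For $g\in G$, $\mathrm{SL}(g)$ is the $<_{\mathrm{SL}}$-minimal word in $(\Sigma\cup\Sigma^{-1})^*$ representing $g$, and $\mathrm{SL}_G=\{\mathrm{SL}(g):g\in G\}$. Fellow travelling. A word $w=s_1\cdots s_n$ determines the path in the Cayley graph of $G$ with respect to $\Sigma$ with vertices $v_0=1_G$, $v_i=s_1\cdots s_i$. For $K\ge 0$, two paths with vertex sequences $v_0,\dots,v_n$ and $u_0,\dots,u_m$ asynchronously $K$-fellow travel if there are non-decreasing maps $f:\{0,\dots,n\}\to\{0,\dots,m\}$ and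 $g:\{0,\dots,m\}\to\{0,\dots,n\}$ such that $d(v_i,u_{f(i)})\le K$ for all $i$ and $d(u_j,v_{g(j)})\le K$ for all $j$, where $d$ is the graph distance. Two words asynchronously $K$-fellow travel if their paths starting at $1_G$ do. SL-FFTP. $G$ has the shortlex falsification by fellow traveller property with respect to $\Sigma$ (and $<$) if there is a constant $K\ge0$ such that for every word $w\in(\Sigma\cup\Sigma^{-1})^*$ with $w\notin\mathrm{SL}_G$ there is a word $v\in(\Sigma\cup\Sigma^{-1})^*$ that asynchronously $K$-fellow travels with $w$ and satisfies $w=_Gv$ and $v<_{\mathrm{SL}}w$. A language is regular if it is the language accepted by a finite state automaton. *)

theory Defs
  imports Complex_Main "HOL-Algebra.Generated_Groups"
begin

definition letters :: "('a, 'b) monoid_scheme \<Rightarrow> 'a set \<Rightarrow> 'a set" where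
  "letters G S = S \<union> m_inv G ` S"

definition word_val :: "('a, 'b) monoid_scheme \<Rightarrow> 'a list \<Rightarrow> 'a" where
  "word_val G w = foldr (\<otimes>\<^bsub>G\<^esub>) w \<one>\<^bsub>G\<^esub>"

text \<open>
  A strict total order on the alphabet is given as a relation \<open>r\<close>, and the induced shortlex order
  is the library's \<^const>\<open>lenlex\<close>. Words are the elements of \<open>lists (letters G S)\<close>.
\<close>

definition is_SL :: "('a, 'b) monoid_scheme \<Rightarrow> 'a set \<Rightarrow> ('a \<times> 'a) set \<Rightarrow> 'a \<Rightarrow> 'a list \<Rightarrow> bool" where
  "is_SL G S r g w \<longleftrightarrow>
     w \<in> lists (letters G S) \<and> word_val G w = g \<and>
     (\<forall>v \<in> lists (letters G S). word_val G v = g \<longrightarrow> (v, w) \<notin> lenlex r)"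

definition SL :: "('a, 'b) monoid_scheme \<Rightarrow> 'a set \<Rightarrow> ('a \<times> 'a) set \<Rightarrow> 'a \<Rightarrow> 'a list" where
  "SL G S r g = (THE w. is_SL G S r g w)"

definition SL_set :: "('a, 'b) monoid_scheme \<Rightarrow> 'a set \<Rightarrow> ('a \<times> 'a) set \<Rightarrow> 'a list set" where
  "SL_set G S r = SL G S r ` carrier G"

text \<open>
  The adjacency relation of the Cayley graph is symmetric because \<^const>\<open>letters\<close> is closed under
  inverses; the graph distance is the least length of an edge path. It is total on the carrier when
  \<open>S\<close> generates \<open>G\<close> (see \<open>cayley_connected\<close> below).
\<close>

definition cayley_edges :: "('a, 'b) monoid_scheme \<Rightarrow> 'a set \<Rightarrow> ('a \<times> 'a) set" where
  "cayley_edges G S = {(g, g \<otimes>\<^bsub>G\<^esub> s) | g s. g \<in> carrier G \<and> s \<in> letters G S}"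

definition cayley_dist :: "('a, 'b) monoid_scheme \<Rightarrow> 'a set \<Rightarrow> 'a \<Rightarrow> 'a \<Rightarrow> nat" where
  "cayley_dist G S g h = (LEAST n. (g, h) \<in> cayley_edges G S ^^ n)"

text \<open>Paths are given by their vertex sequences \<open>p 0, \<dots>, p n\<close> and \<open>q 0, \<dots>, q m\<close>.\<close>

definition async_fellow_travel_paths ::
  "('a, 'b) monoid_scheme \<Rightarrow> 'a set \<Rightarrow> real \<Rightarrow> nat \<Rightarrow> (nat \<Rightarrow> 'a) \<Rightarrow> nat \<Rightarrow> (nat \<Rightarrow> 'a) \<Rightarrow> bool" where
  "async_fellow_travel_paths G S K n p m q \<longleftrightarrow>
     (\<exists>f g. f \<in> {0..n} \<rightarrow> {0..m} \<and> mono_on {0..n} f \<and>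
            g \<in> {0..m} \<rightarrow> {0..n} \<and> mono_on {0..m} g \<and>
            (\<forall>i \<in> {0..n}. real (cayley_dist G S (p i) (q (f i))) \<le> K) \<and>
            (\<forall>j \<in> {0..m}. real (cayley_dist G S (q j) (p (g j))) \<le> K))"

definition word_path :: "('a, 'b) monoid_scheme \<Rightarrow> 'a list \<Rightarrow> nat \<Rightarrow> 'a" where
  "word_path G w i = word_val G (take i w)"

definition async_fellow_travel ::
  "('a, 'b) monoid_scheme \<Rightarrow> 'a set \<Rightarrow> real \<Rightarrow> 'a list \<Rightarrow> 'a list \<Rightarrow> bool" where
  "async_fellow_travel G S K w v \<longleftrightarrow>
     async_fellow_travel_paths G S K (length w) (word_path G w) (length v) (word_path G v)"

definition SL_FFTP :: "('a, 'b) monoid_scheme \<Rightarrow> 'a set \<Rightarrow> ('a \<times> 'a) set \<Rightarrow> bool" where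
  "SL_FFTP G S r \<longleftrightarrow>
     (\<exists>K \<ge> 0. \<forall>w \<in> lists (letters G S). w \<notin> SL_set G S r \<longrightarrow>
        (\<exists>v \<in> lists (letters G S).
           async_fellow_travel G S K w v \<and> word_val G w = word_val G v \<and> (v, w) \<in> lenlex r))"

definition is_dfa :: "'a set \<Rightarrow> 'q set \<Rightarrow> ('q \<Rightarrow> 'a \<Rightarrow> 'q) \<Rightarrow> 'q \<Rightarrow> 'q set \<Rightarrow> bool" where
  "is_dfa A Q \<delta> q0 F \<longleftrightarrow>
     finite A \<and> finite Q \<and> q0 \<in> Q \<and> F \<subseteq> Q \<and> (\<forall>q \<in> Q. \<forall>a \<in> A. \<delta> q a \<in> Q)"

definition dfa_language :: "'a set \<Rightarrow> ('q \<Rightarrow> 'a \<Rightarrow> 'q) \<Rightarrow> 'q \<Rightarrow> 'q set \<Rightarrow> 'a list set" where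
  "dfa_language A \<delta> q0 F = {w \<in> lists A. foldl \<delta> q0 w \<in> F}"

text \<open>Finite state sets can be taken to consist of natural numbers without loss of generality.\<close>

definition regular_language :: "'a set \<Rightarrow> 'a list set \<Rightarrow> bool" where
  "regular_language A L \<longleftrightarrow>
     (\<exists>(Q :: nat set) \<delta> q0 F. is_dfa A Q \<delta> q0 F \<and> L = dfa_language A \<delta> q0 F)"

text \<open>
  Well-definedness: the descriptions in \<^const>\<open>SL\<close> and \<^const>\<open>cayley_dist\<close> denote.
\<close>

context group
begin

lemma letters_closed: "S \<subseteq> carrier G \<Longrightarrow> letters G S \<subseteq> carrier G"
  by (auto simp: letters_def)

lemma word_val_closed: "w \<in> lists (carrier G) \<Longrightarrow> word_val G w \<in> carrier G"
  by (induction w) (auto simp: word_val_def)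

lemma word_val_append:
  "\<lbrakk>u \<in> lists (carrier G); v \<in> lists (carrier G)\<rbrakk>
   \<Longrightarrow> word_val G (u @ v) = word_val G u \<otimes> word_val G v"
proof (induction u)
  case Nil
  then show ?case using word_val_closed[of v] by (simp add: word_val_def)
next
  case (Cons a u)
  then show ?case
    using word_val_closed[of u] word_val_closed[of v] by (simp add: word_val_def m_assoc)
qed

lemma word_val_surj:
  assumes S: "S \<subseteq> carrier G" and g: "g \<in> generate G S"
  shows "\<exists>w \<in> lists (letters G S). word_val G w = g"
  using g
proof (induction rule: generate.induct)
  case one
  show ?case by (rule bexI[of _ "[]"]) (auto simp: word_val_def)
next
  case (incl h)
  then show ?case using S
    by (intro bexI[of _ "[h]"]) (auto simp: word_val_def letters_def)
next
  case (inv h)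
  then show ?case using S
    by (intro bexI[of _ "[inv h]"]) (auto simp: word_val_def letters_def)
next
  case (eng h1 h2)
  then obtain u v where "u \<in> lists (letters G S)" "word_val G u = h1"
    "v \<in> lists (letters G S)" "word_val G v = h2" by blast
  moreover from this have "u \<in> lists (carrier G)" "v \<in> lists (carrier G)"
    using lists_mono[OF letters_closed[OF S]] by blast+
  ultimately show ?case
    by (intro bexI[of _ "u @ v"]) (auto simp: word_val_append)
qed

lemma SL_ex1:
  assumes "finite S" "S \<subseteq> carrier G" "generate G S = carrier G"
    and r: "r \<subseteq> letters G S \<times> letters G S" "strict_linear_order_on (letters G S) r"
    and g: "g \<in> carrier G"
  shows "\<exists>!w. is_SL G S r g w"
proof -
  let ?A = "letters G S" and ?W = "{w \<in> lists (letters G S). word_val G w = g}"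
  have "finite ?A" using assms(1) by (simp add: letters_def)
  then have "finite r" using r(1) by (meson finite_SigmaI finite_subset)
  moreover have "acyclic r" using r(2)
    by (simp add: strict_linear_order_on_def acyclic_irrefl)
  ultimately have "wf (lenlex r)" by (intro wf_lenlex finite_acyclic_wf)
  moreover have "?W \<noteq> {}" using word_val_surj[OF assms(2)] g assms(3) by auto
  ultimately obtain w where w: "w \<in> ?W" "\<And>v. (v, w) \<in> lenlex r \<Longrightarrow> v \<notin> ?W"
    by (meson ex_in_conv wfE_min)
  have tot: "(u, v) \<in> lenlex r \<or> (v, u) \<in> lenlex r"
    if "u \<in> lists ?A" "v \<in> lists ?A" "u \<noteq> v" "length u = length v" for u v
    using that(4,1-3)
  proof (induction rule: list_induct2)
    case (Cons x xs y ys)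
    then show ?case using r(2)
      by (auto simp: Cons_lenlex_iff strict_linear_order_on_def total_on_def)
  qed simp
  show ?thesis
  proof (rule ex1I[of _ w])
    show "is_SL G S r g w" using w by (auto simp: is_SL_def)
    fix v assume v: "is_SL G S r g v"
    then have "(v, w) \<notin> lenlex r" "(w, v) \<notin> lenlex r" using w by (auto simp: is_SL_def)
    moreover from this have "length v = length w"
      by (auto simp: lenlex_conv)
    ultimately show "v = w" using tot[of v w] v w(1) by (auto simp: is_SL_def)
  qed
qed

lemma cayley_connected:
  assumes S: "S \<subseteq> carrier G" "generate G S = carrier G"
    and g: "g \<in> carrier G" and h: "h \<in> carrier G"
  shows "\<exists>n. (g, h) \<in> cayley_edges G S ^^ n"
proof -
  have path: "(x, x \<otimes> word_val G w) \<in> cayley_edges G S ^^ length w"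
    if "w \<in> lists (letters G S)" "x \<in> carrier G" for w x
    using that
  proof (induction w arbitrary: x rule: list.induct)
    case Nil
    then show ?case by (simp add: word_val_def)
  next
    case (Cons a w)
    have c: "a \<in> carrier G" "w \<in> lists (carrier G)"
      using Cons.prems(1) letters_closed[OF S(1)] by auto
    have "(x, x \<otimes> a) \<in> cayley_edges G S"
      using Cons.prems by (auto simp: cayley_edges_def)
    moreover have "(x \<otimes> a, (x \<otimes> a) \<otimes> word_val G w) \<in> cayley_edges G S ^^ length w"
      using Cons.prems c by (intro Cons.IH) auto
    moreover have "(x \<otimes> a) \<otimes> word_val G w = x \<otimes> word_val G (a # w)"
      using c Cons.prems word_val_closed[of w] by (simp add: word_val_def m_assoc)
    ultimately show ?case by (metis length_Cons relpow_Suc_I2)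
  qed
  obtain w where "w \<in> lists (letters G S)" "word_val G w = inv g \<otimes> h"
    using word_val_surj[OF S(1)] S(2) g h by (metis inv_closed m_closed)
  with path[of w g] g h have "(g, h) \<in> cayley_edges G S ^^ length w"
    by (metis inv_closed l_one m_assoc r_inv)
  then show ?thesis by blast
qed

end

end

theory Submission
  imports Defs
begin

text \<open>
  An automaton reads \<open>w\<close> and keeps track of every competitor \<open>v\<close> that stays within bounded distance
  of \<open>w\<close>, remembering only the group element separating the two endpoints, the difference of the
  lengths, and whether \<open>v\<close> has already become lexicographically smaller. The word is rejected as
  soon as some competitor reaches the same group element and is shortlex smaller. The first
  prefix \<open>w = w'a\<close> that is not a shortlex representative is geodesic up to an error of 2, so along
  a \<open>K\<close>-fellow traveller \<open>v\<close> of \<open>w\<close> matched positions differ by at most \<open>K + 2\<close>, and finitely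
  many states suffice.
\<close>

section \<open>Automata over arbitrary finite state types\<close>

text \<open>States are renamed to natural numbers along a bijection \<open>h\<close>. The inverse of
  \<open>h\<close> is meaningful only on the image of \<open>Q\<close>, which suffices because runs
  from \<open>q0\<close> never leave \<open>Q\<close>.\<close>

lemma regular_languageI:
  fixes Q :: "'q set"
  assumes "is_dfa A Q \<delta> q0 F"
  shows "regular_language A (dfa_language A \<delta> q0 F)"
proof -
  have A: "finite A" and Q: "finite Q" and q0: "q0 \<in> Q" and F: "F \<subseteq> Q"
    and \<delta>: "\<And>q a. q \<in> Q \<Longrightarrow> a \<in> A \<Longrightarrow> \<delta> q a \<in> Q"
    using assms by (auto simp: is_dfa_def)
  obtain h where h: "bij_betw h Q {0..<card Q}"
    using ex_bij_betw_finite_nat[OF Q] by blast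
  define \<delta>' where "\<delta>' n a = h (\<delta> (inv_into Q h n) a)" for n a
  have inj: "inj_on h Q" using h by (simp add: bij_betw_def)
  have run: "foldl \<delta> q w \<in> Q \<and> foldl \<delta>' (h q) w = h (foldl \<delta> q w)"
    if "q \<in> Q" "w \<in> lists A" for q w
    using that
  proof (induction w arbitrary: q)
    case (Cons a w)
    then show ?case using \<delta> by (simp add: \<delta>'_def inv_into_f_f[OF inj])
  qed simp
  have "is_dfa A (h ` Q) \<delta>' (h q0) (h ` F)"
    using A Q q0 F \<delta> by (auto simp: is_dfa_def \<delta>'_def inv_into_f_f[OF inj])
  moreover have "dfa_language A \<delta> q0 F = dfa_language A \<delta>' (h q0) (h ` F)"
  proof -
    have "foldl \<delta> q0 w \<in> F \<longleftrightarrow> foldl \<delta>' (h q0) w \<in> h ` F" if "w \<in> lists A" for w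
      using run[OF q0 that] inj_on_image_mem_iff[OF inj _ F] by metis
    then show ?thesis by (auto simp: dfa_language_def)
  qed
  ultimately show ?thesis unfolding regular_language_def by blast
qed

section \<open>Words, values and balls in the Cayley graph\<close>

locale shortlex_group = group G for G (structure) +
  fixes S :: "'a set" and r :: "('a \<times> 'a) set"
  assumes finite_S: "finite S" and S_closed: "S \<subseteq> carrier G"
    and S_generates: "generate G S = carrier G"
    and r_letters: "r \<subseteq> letters G S \<times> letters G S"
    and r_order: "strict_linear_order_on (letters G S) r"
begin

abbreviation "A \<equiv> letters G S"
abbreviation "val \<equiv> word_val G"

definition reduced :: "'a list \<Rightarrow> bool" where
  "reduced w \<longleftrightarrow> w \<in> lists A \<and> (\<forall>v \<in> lists A. val v = val w \<longrightarrow> (v, w) \<notin> lenlex r)"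

definition words :: "nat \<Rightarrow> 'a list set" where
  "words n = {w \<in> lists A. length w \<le> n}"

text \<open>This is the ball of radius \<open>n\<close> about the identity. Closeness of vertices
  \<open>g\<close> and \<open>h\<close> is expressed as
  \<open>inv g \<otimes> h \<in> ball n\<close>, so distance estimates become concatenation of
  words.\<close>

definition ball :: "nat \<Rightarrow> 'a set" where
  "ball n = val ` words n"

lemma mult_inv_cancel [simp]:
  assumes "x \<in> carrier G" "y \<in> carrier G"
  shows "x \<otimes> (inv x \<otimes> y) = y" and "inv x \<otimes> (x \<otimes> y) = y"
  using assms by (simp_all add: m_assoc[symmetric])

lemma finite_letters: "finite A"
  using finite_S by (simp add: letters_def)

lemma letter_closed [simp]: "a \<in> A \<Longrightarrow> a \<in> carrier G"
  using letters_closed[OF S_closed] by blast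

lemma letter_inv: "a \<in> A \<Longrightarrow> inv a \<in> A"
  using S_closed by (auto simp: letters_def)

lemma lists_closed: "w \<in> lists A \<Longrightarrow> w \<in> lists (carrier G)"
  using lists_mono[OF letters_closed[OF S_closed]] by blast

lemma val_closed [simp]: "w \<in> lists A \<Longrightarrow> val w \<in> carrier G"
  by (simp add: lists_closed word_val_closed)

lemma val_append: "u \<in> lists A \<Longrightarrow> v \<in> lists A \<Longrightarrow> val (u @ v) = val u \<otimes> val v"
  by (simp add: lists_closed word_val_append)

lemma val_Nil [simp]: "val [] = \<one>"
  by (simp add: word_val_def)

lemma val_Cons: "val (a # w) = a \<otimes> val w"
  by (simp add: word_val_def)

lemma take_lists [simp]: "w \<in> lists X \<Longrightarrow> take i w \<in> lists X"
  by (auto dest: in_set_takeD)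

lemma drop_lists [simp]: "w \<in> lists X \<Longrightarrow> drop i w \<in> lists X"
  by (auto dest: in_set_dropD)

lemma finite_words: "finite (words n)"
proof -
  have "words n = {w. set w \<subseteq> A \<and> length w \<le> n}" by (auto simp: words_def)
  then show ?thesis using finite_lists_length_le[OF finite_letters] by simp
qed

lemma finite_ball: "finite (ball n)"
  by (simp add: ball_def finite_words)

lemma val_in_ball: "w \<in> lists A \<Longrightarrow> length w \<le> n \<Longrightarrow> val w \<in> ball n"
  by (auto simp: ball_def words_def)

lemma ballE:
  assumes "x \<in> ball n"
  obtains w where "w \<in> lists A" "length w \<le> n" "x = val w"
  using assms by (auto simp: ball_def words_def)

lemma ball_mono: "x \<in> ball m \<Longrightarrow> m \<le> n \<Longrightarrow> x \<in> ball n"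
  by (auto simp: ball_def words_def)

lemma ball_mult: "x \<in> ball m \<Longrightarrow> y \<in> ball n \<Longrightarrow> x \<otimes> y \<in> ball (m + n)"
  by (elim ballE) (auto simp: val_append[symmetric] intro!: val_in_ball)

lemma val_inverse:
  assumes "w \<in> lists A"
  shows "\<exists>u \<in> lists A. length u = length w \<and> val u = inv (val w)"
  using assms
proof (induction w)
  case (Cons a w)
  then obtain u where u: "u \<in> lists A" "length u = length w" "val u = inv (val w)" by auto
  have "val (u @ [inv a]) = inv (val (a # w))"
    using Cons.hyps u letter_inv[of a]
    by (simp add: val_append val_Cons inv_mult_group)
  then show ?case using u Cons.hyps letter_inv[of a]
    by (intro bexI[of _ "u @ [inv a]"]) auto
qed auto

lemma ball_inv:
  assumes "x \<in> ball n" shows "inv x \<in> ball n"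
proof -
  obtain w where w: "w \<in> lists A" "length w \<le> n" "x = val w" using assms by (rule ballE)
  with val_inverse[of w] show ?thesis using val_in_ball by metis
qed

lemma val_take_drop:
  assumes "w \<in> lists A"
  shows "val (take i w) \<otimes> val (drop i w) = val w"
  using val_append[of "take i w" "drop i w"] assms by simp

lemma val_take_split:
  assumes "w \<in> lists A" "i \<le> j"
  shows "val (take i w) \<otimes> val (drop i (take j w)) = val (take j w)"
  using val_take_drop[of "take j w" i] assms by (simp add: min_absorb1)

lemma inv_take_in_ball:
  assumes "w \<in> lists A" "i \<le> j"
  shows "inv (val (take i w)) \<otimes> val (take j w) \<in> ball (j - i)"
proof -
  have "inv (val (take i w)) \<otimes> val (take j w) = val (drop i (take j w))"
    using val_take_split[OF assms] assms
    by (metis inv_solve_left drop_lists take_lists val_closed)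
  moreover have "val (drop i (take j w)) \<in> ball (j - i)"
    using assms by (intro val_in_ball take_lists drop_lists) auto
  ultimately show ?thesis by simp
qed

lemma relpow_cayley:
  assumes "(g, h) \<in> cayley_edges G S ^^ n" "g \<in> carrier G"
  shows "\<exists>w \<in> lists A. length w = n \<and> h = g \<otimes> val w"
  using assms
proof (induction n arbitrary: h)
  case (Suc n)
  then obtain h' s where h': "(g, h') \<in> cayley_edges G S ^^ n" "s \<in> A" "h = h' \<otimes> s"
    by (auto simp: cayley_edges_def)
  then obtain w where w: "w \<in> lists A" "length w = n" "h' = g \<otimes> val w"
    using Suc by blast
  have "h = g \<otimes> val (w @ [s])"
    using w h' Suc.prems by (simp add: val_append val_Cons m_assoc)
  then show ?case using w h' by (intro bexI[of _ "w @ [s]"]) auto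
qed auto

text \<open>Connectedness makes the minimum in \<open>cayley_dist\<close> attained; the labels along
  a shortest path then spell a word for \<open>inv g \<otimes> h\<close>.\<close>

lemma cayley_dist_ball:
  assumes "g \<in> carrier G" "h \<in> carrier G" "cayley_dist G S g h \<le> n"
  shows "inv g \<otimes> h \<in> ball n"
proof -
  have "(g, h) \<in> cayley_edges G S ^^ cayley_dist G S g h"
    unfolding cayley_dist_def
    using cayley_connected[OF S_closed S_generates assms(1,2)] by (rule LeastI_ex)
  then obtain w where w: "w \<in> lists A" "length w = cayley_dist G S g h" "h = g \<otimes> val w"
    using relpow_cayley assms(1) by blast
  then have "inv g \<otimes> h = val w" using assms
    by (simp add: m_assoc[symmetric])
  then show ?thesis using w assms(3) by (auto intro: val_in_ball)
qed

section \<open>Shortlex representatives as reduced words\<close>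

lemma SL_set_eq: "SL_set G S r = {w. reduced w}"
proof -
  note ex1 = SL_ex1[OF finite_S S_closed S_generates r_letters r_order]
  have SL: "is_SL G S r g (SL G S r g)" if "g \<in> carrier G" for g
    unfolding SL_def using ex1[OF that] by (rule theI')
  show ?thesis
  proof (intro subset_antisym subsetI CollectI)
    fix w assume "w \<in> SL_set G S r"
    then obtain g where "is_SL G S r g w" using SL by (auto simp: SL_set_def)
    then show "reduced w" by (auto simp: is_SL_def reduced_def)
  next
    fix w assume "w \<in> {w. reduced w}"
    then have "is_SL G S r (val w) w" "val w \<in> carrier G"
      by (auto simp: is_SL_def reduced_def)
    moreover from this have "w = SL G S r (val w)"
      using ex1 SL by metis
    ultimately show "w \<in> SL_set G S r" by (auto simp: SL_set_def)
  qed
qed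

lemma lenlex_append_same:
  assumes "(v, w) \<in> lenlex r" shows "(v @ z, w @ z) \<in> lenlex r"
proof (cases "length v < length w")
  case False
  then obtain c s x t y where "v = c @ s # x" "w = c @ t # y" "(s, t) \<in> r"
    "length v = length w" using assms by (auto simp: lenlex_conv lex_conv)
  then have "v @ z = c @ s # (x @ z)" "w @ z = c @ t # (y @ z)" "(s, t) \<in> r"
    "length (v @ z) = length (w @ z)" by auto
  then show ?thesis unfolding lenlex_conv lex_conv by blast
qed (simp add: lenlex_conv)

text \<open>Replacing a prefix by a smaller word of the same value makes the whole word smaller.
  Hence a word with a non-reduced prefix can be rejected for good.\<close>

lemma reduced_prefix:
  assumes "reduced (w @ z)" shows "reduced w"
  unfolding reduced_def
proof (intro conjI ballI impI notI)
  show w: "w \<in> lists A" using assms by (simp add: reduced_def)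
  fix v assume "v \<in> lists A" "val v = val w" "(v, w) \<in> lenlex r"
  then show False using assms w lenlex_append_same[of v w z]
    by (auto simp: reduced_def val_append dest!: bspec[of _ _ "v @ z"])
qed

section \<open>The token automaton\<close>

text \<open>
  A token \<open>(g, k, l)\<close> after reading \<open>w\<close> stands for a word \<open>v\<close> ending at \<open>w g\<close>
  with \<open>|v| = |w| + k\<close>, where \<open>l\<close> records that \<open>v\<close> has branched off from \<open>w\<close> by a smaller letter.
  Each letter of \<open>w\<close> is matched by a whole block of letters of \<open>v\<close>.
\<close>

type_synonym 'x token = "'x \<times> int \<times> bool"

definition tokens :: "nat \<Rightarrow> 'a token set" where
  "tokens R = ball R \<times> {- int R..int R} \<times> UNIV"

text \<open>The first set extends competitors already tracked. The second creates one that has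
  copied the input so far and now leaves it by a smaller letter, so it needs no token in
  \<open>X\<close>. Blocks of length \<open>2 * R + 1\<close> suffice, since the length difference
  moves within an interval from \<open>- R\<close> to \<open>R\<close>.\<close>

definition step :: "nat \<Rightarrow> 'a token set \<Rightarrow> 'a \<Rightarrow> 'a token set" where
  "step R X a = tokens R \<inter>
     ({(inv a \<otimes> g \<otimes> val b, k + int (length b) - 1, l) | g k l b.
         (g, k, l) \<in> X \<and> b \<in> words (2 * R + 1)} \<union>
      {(inv a \<otimes> val b, int (length b) - 1, True) | b.
         b \<in> words (2 * R + 1) \<and> b \<noteq> [] \<and> (hd b, a) \<in> r})"

definition beaten :: "'a token set \<Rightarrow> bool" where
  "beaten X \<longleftrightarrow> (\<exists>k l. (\<one>, k, l) \<in> X \<and> (k < 0 \<or> k = 0 \<and> l))"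

text \<open>Freezing a beaten state makes rejection permanent, in accordance with
  \<open>reduced_prefix\<close>.\<close>

definition sticky_step :: "nat \<Rightarrow> 'a token set \<Rightarrow> 'a \<Rightarrow> 'a token set" where
  "sticky_step R X a = (if beaten X then X else step R X a)"

abbreviation "start \<equiv> {(\<one>, 0, False)}"

lemma is_dfa_tokens:
  "is_dfa A (Pow (tokens R)) (sticky_step R) start {X \<in> Pow (tokens R). \<not> beaten X}"
proof -
  have "\<one> \<in> ball R" using val_in_ball[of "[]" R] by simp
  then show ?thesis
    by (auto simp: is_dfa_def sticky_step_def step_def tokens_def finite_letters finite_ball)
qed

lemma stepE:
  assumes "(g, k, l) \<in> step R X a"
  obtains (old) g' k' b where "(g', k', l) \<in> X" "b \<in> lists A"
      "g = inv a \<otimes> g' \<otimes> val b" "k = k' + int (length b) - 1"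
    | (branch) b where "b \<in> lists A" "b \<noteq> []" "(hd b, a) \<in> r" "l"
      "g = inv a \<otimes> val b" "k = int (length b) - 1"
  using assms by (auto simp: step_def words_def simp del: in_lists_conv_set)

lemma step_oldI:
  assumes "(g, k, l) \<in> X" "b \<in> words (2 * R + 1)" "(g', k', l) \<in> tokens R"
    and "g' = inv a \<otimes> g \<otimes> val b" "k' = k + int (length b) - 1"
  shows "(g', k', l) \<in> step R X a"
  using assms unfolding step_def by blast

lemma step_branchI:
  assumes "b \<in> words (2 * R + 1)" "b \<noteq> []" "(hd b, a) \<in> r" "(g, k, True) \<in> tokens R"
    and "g = inv a \<otimes> val b" "k = int (length b) - 1"
  shows "(g, k, True) \<in> step R X a"
  using assms unfolding step_def by blast

section \<open>Soundness: tokens come from actual words\<close>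

text \<open>Induction on the input from the right: an old token extends its competitor
  \<open>v\<close> to \<open>v @ b\<close>, and a branching token has the competitor
  \<open>w @ b\<close>.\<close>

lemma step_sound:
  assumes "w \<in> lists A" "(g, k, l) \<in> foldl (step R) start w"
  shows "g \<in> carrier G \<and> (\<exists>v \<in> lists A. val v = val w \<otimes> g \<and> int (length v) = int (length w) + k \<and>
    (l \<longrightarrow> (\<exists>c s x t y. w = c @ s # x \<and> v = c @ t # y \<and> (t, s) \<in> r)))"
  using assms
proof (induction w arbitrary: g k l rule: rev_induct)
  case Nil
  then show ?case by (auto intro!: bexI[of _ "[]"])
next
  case (snoc a w)
  then have w: "w \<in> lists A" and a: "a \<in> A" by auto
  from snoc.prems have "(g, k, l) \<in> step R (foldl (step R) start w) a" by simp
  then show ?case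
  proof (cases rule: stepE)
    case (old g' k' b)
    from snoc.IH[OF w old(1)] obtain v where g': "g' \<in> carrier G"
      and v: "v \<in> lists A" "val v = val w \<otimes> g'" "int (length v) = int (length w) + k'"
      and l: "l \<longrightarrow> (\<exists>c s x t y. w = c @ s # x \<and> v = c @ t # y \<and> (t, s) \<in> r)" by metis
    show ?thesis
    proof (intro bexI[of _ "v @ b"] conjI impI)
      show "val (v @ b) = val (w @ [a]) \<otimes> g"
        using w a g' v old by (simp add: val_append val_Cons m_assoc)
      show "\<exists>c s x t y. w @ [a] = c @ s # x \<and> v @ b = c @ t # y \<and> (t, s) \<in> r" if l
        using l that by force
    qed (use w a g' v old in auto)
  next
    case (branch b)
    show ?thesis
    proof (intro bexI[of _ "w @ b"] conjI impI)
      show "val (w @ b) = val (w @ [a]) \<otimes> g"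
        using w a branch by (simp add: val_append val_Cons m_assoc)
      show "\<exists>c s x t y. w @ [a] = c @ s # x \<and> w @ b = c @ t # y \<and> (t, s) \<in> r"
        using branch by (metis list.collapse)
    qed (use w a branch in auto)
  qed
qed

lemma beaten_not_reduced:
  assumes "w \<in> lists A" "beaten (foldl (step R) start w)"
  shows "\<not> reduced w"
proof -
  obtain k l where kl: "(\<one>, k, l) \<in> foldl (step R) start w" "k < 0 \<or> k = 0 \<and> l"
    using assms(2) by (auto simp: beaten_def)
  from step_sound[OF assms(1) kl(1)] obtain v where v: "v \<in> lists A" "val v = val w"
    "int (length v) = int (length w) + k"
    "l \<longrightarrow> (\<exists>c s x t y. w = c @ s # x \<and> v = c @ t # y \<and> (t, s) \<in> r)"
    using assms(1) val_closed[OF assms(1)] by (metis r_one)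
  have "(v, w) \<in> lenlex r"
  proof (cases "k < 0")
    case False
    then obtain c s x t y where "w = c @ s # x" "v = c @ t # y" "(t, s) \<in> r"
      using v(4) kl(2) by auto
    moreover have "length v = length w" using False kl(2) v(3) by auto
    ultimately show ?thesis unfolding lenlex_conv lex_conv by blast
  qed (use v(3) in \<open>simp add: lenlex_conv\<close>)
  then show ?thesis using v by (auto simp: reduced_def)
qed

section \<open>Completeness: fellow travellers are tracked\<close>

text \<open>The letter of \<open>w\<close> at position \<open>i\<close> is matched with the block of
  \<open>v\<close> between \<open>f i\<close> and \<open>f (Suc i)\<close>. The start
  \<open>p\<close> is arbitrary so that tracking can also begin just after a branch point.\<close>

lemma step_track:
  assumes w: "w \<in> lists A" and v: "v \<in> lists A"
    and "p \<le> q" "q \<le> length w"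
    and "\<And>i. p \<le> i \<Longrightarrow> i \<le> q \<Longrightarrow> f i \<le> length v"
      "\<And>i. p \<le> i \<Longrightarrow> i < q \<Longrightarrow> f i \<le> f (Suc i)"
      "\<And>i. p \<le> i \<Longrightarrow> i \<le> q \<Longrightarrow> \<bar>int (f i) - int i\<bar> \<le> int R"
      "\<And>i. p \<le> i \<Longrightarrow> i \<le> q \<Longrightarrow> inv (val (take i w)) \<otimes> val (take (f i) v) \<in> ball R"
    and init: "(inv (val (take p w)) \<otimes> val (take (f p) v), int (f p) - int p, l)
      \<in> foldl (step R) start (take p w)"
  shows "(inv (val (take q w)) \<otimes> val (take (f q) v), int (f q) - int q, l)
    \<in> foldl (step R) start (take q w)"
  using assms(3-8)
proof (induction q rule: dec_induct)
  case base
  then show ?case using init by simp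
next
  case (step i)
  let ?w = "take i w" and ?v = "take (f i) v" and ?b = "drop (f i) (take (f (Suc i)) v)"
    and ?X = "foldl (step R) start (take i w)"
  have i: "i < length w" and wi: "w ! i \<in> A" using step.prems w by auto
  have f: "f i \<le> f (Suc i)" "f (Suc i) \<le> length v"
    "\<bar>int (f i) - int i\<bar> \<le> int R" "\<bar>int (f (Suc i)) - int (Suc i)\<bar> \<le> int R"
    using step.prems(2,4)[of "Suc i"] step.prems(3,4)[of i] step.hyps by auto
  have tok: "(inv (val ?w) \<otimes> val ?v, int (f i) - int i, l) \<in> ?X"
    using step.prems by (intro step.IH) auto
  have len: "length ?b = f (Suc i) - f i" using f by simp
  have w': "take (Suc i) w = ?w @ [w ! i]" using i by (rule take_Suc_conv_app_nth)
  have "inv (val (take (Suc i) w)) \<otimes> val (take (f (Suc i)) v)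
      = inv (w ! i) \<otimes> (inv (val ?w) \<otimes> val ?v) \<otimes> val ?b"
    using w v wi val_take_split[OF v f(1)]
    by (simp add: w' val_append val_Cons inv_mult_group m_assoc del: take_append)
  moreover have "int (f (Suc i)) - int (Suc i) = int (f i) - int i + int (length ?b) - 1"
    using len f by simp
  \<comment> \<open>The block ends at most at \<open>i + 1 + R\<close> and begins at least at
    \<open>i - R\<close>.\<close>
  moreover have "?b \<in> words (2 * R + 1)" using len f v by (simp add: words_def)
  moreover have "(inv (val (take (Suc i) w)) \<otimes> val (take (f (Suc i)) v),
      int (f (Suc i)) - int (Suc i), l) \<in> tokens R"
    using step.prems(5)[of "Suc i"] step.hyps f by (auto simp: tokens_def)
  ultimately have "(inv (val (take (Suc i) w)) \<otimes> val (take (f (Suc i)) v),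
      int (f (Suc i)) - int (Suc i), l) \<in> step R ?X (w ! i)"
    by (intro step_oldI[OF tok])
  then show ?case by (simp add: w')
qed

text \<open>Crossing from one path to the other along a short connecting word yields words of value
  \<open>val w\<close>. As \<open>w\<close> is within 2 of minimal length, neither crossing can save
  much, which bounds \<open>j - i\<close> from both sides.\<close>

lemma prefix_length_diff:
  assumes red: "reduced w'" and a: "a \<in> A" and w: "w = w' @ [a]"
    and v: "v \<in> lists A" "val v = val w" "length v \<le> length w"
    and i: "i \<le> length w" and j: "j \<le> length v"
    and near: "inv (val (take i w)) \<otimes> val (take j v) \<in> ball K"
  shows "\<bar>int j - int i\<bar> \<le> int K + 2"
proof -
  have w': "w' \<in> lists A" using red by (simp add: reduced_def)
  have wl: "w \<in> lists A" using w w' a by simp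
  \<comment> \<open>One unit pays for the last letter of \<open>w\<close>, the other for
    \<open>inv a\<close>, which turns \<open>z\<close> into a word for the value of the reduced word
    \<open>w'\<close>.\<close>
  have geo: "length w \<le> length z + 2" if z: "z \<in> lists A" "val z = val w" for z
  proof -
    have "val (z @ [inv a]) = val w'"
      using z a w' letter_inv[OF a] by (simp add: w val_append val_Cons m_assoc)
    then have "(z @ [inv a], w') \<notin> lenlex r"
      using red z letter_inv[OF a] by (auto simp: reduced_def)
    then show ?thesis by (auto simp: lenlex_conv w)
  qed
  obtain b where b: "b \<in> lists A" "length b \<le> K"
    "inv (val (take i w)) \<otimes> val (take j v) = val b" using near by (rule ballE)
  obtain b' where b': "b' \<in> lists A" "length b' = length b" "val b' = inv (val b)"
    using val_inverse[OF b(1)] by blast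
  have vb: "val (take j v) = val (take i w) \<otimes> val b"
    using b wl v(1) by (metis inv_solve_left take_lists val_closed)
  then have wb: "val (take i w) = val (take j v) \<otimes> val b'"
    using b b' wl by (simp add: m_assoc)
  \<comment> \<open>First crossing, from \<open>w\<close> to \<open>v\<close>; the reverse crossing
    below uses \<open>b'\<close>.\<close>
  have "val (take i w @ b @ drop j v) = val w"
    using b wl v vb val_take_drop[OF v(1), of j] by (simp add: val_append m_assoc)
  from geo[OF _ this] have 1: "length w \<le> i + length b + (length v - j) + 2"
    using b wl v i by (simp add: add.assoc)
  have "val (take j v @ b' @ drop i w) = val w"
    using b b' wl v(1) wb val_take_drop[OF wl, of i] by (simp add: val_append m_assoc)
  from geo[OF _ this] have "length w \<le> j + length b' + (length w - i) + 2"
    using b' wl v j by (simp add: add.assoc)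
  with 1 show ?thesis using b(2) b'(2) v(3) i j by linarith
qed

text \<open>A shorter \<open>v\<close> is tracked from the start with flag \<open>False\<close>; one
  of equal length is tracked from its first difference with flag \<open>True\<close>. The radius
  \<open>K + 3\<close> is the bound \<open>K + 2\<close> on the length difference plus one letter at
  the branch point.\<close>

lemma step_complete:
  assumes red: "reduced w'" and a: "a \<in> A" and w: "w = w' @ [a]"
    and v: "v \<in> lists A" "val v = val w" "(v, w) \<in> lenlex r"
    and f: "\<And>i. i \<le> length w \<Longrightarrow> f i \<le> length v"
      "\<And>i j. i \<le> j \<Longrightarrow> j \<le> length w \<Longrightarrow> f i \<le> f j"
      "\<And>i. i \<le> length w \<Longrightarrow> inv (val (take i w)) \<otimes> val (take (f i) v) \<in> ball K"
  shows "beaten (foldl (step (K + 3)) start w)"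
proof -
  let ?n = "length w" and ?m = "length v" and ?R = "K + 3"
  have wl: "w \<in> lists A" using red w a by (simp add: reduced_def)
  have len: "?m \<le> ?n" using v(3) by (auto simp: lenlex_conv)
  have one: "\<one> \<in> ball K" using val_in_ball[of "[]" K] by simp
  \<comment> \<open>Fellow travelling does not force \<open>f\<close> to match endpoints with
    endpoints. Resetting both values preserves monotonicity and closeness, as the two paths share
    their endpoints; they do not conflict because \<open>w\<close> is nonempty.\<close>
  define h where "h i = (if i = 0 then 0 else if i = ?n then ?m else f i)" for i
  have h_le: "h i \<le> ?m" if "i \<le> ?n" for i using f(1) that by (simp add: h_def)
  have h_mono: "h i \<le> h (Suc i)" if "i < ?n" for i
    using that f(1)[of i] f(2)[of i "Suc i"] by (auto simp: h_def)
  have h_near: "inv (val (take i w)) \<otimes> val (take (h i) v) \<in> ball K" if "i \<le> ?n" for i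
    using that f(3)[of i] one wl v by (auto simp: h_def)
  have h_diff: "\<bar>int (h i) - int i\<bar> \<le> int K + 2" if "i \<le> ?n" for i
    using prefix_length_diff[OF red a w v(1,2) len that h_le h_near] that by blast
  have h_n: "h ?n = ?m" using w by (simp add: h_def)
  consider "?m < ?n" | c s x t y where "?m = ?n" "w = c @ s # x" "v = c @ t # y" "(t, s) \<in> r"
    using v(3) by (auto simp: lenlex_conv lex_conv)
  then show ?thesis
  proof cases
    case 1
    have "(inv (val (take ?n w)) \<otimes> val (take (h ?n) v), int (h ?n) - int ?n, False)
        \<in> foldl (step ?R) start (take ?n w)"
    proof (rule step_track[OF wl v(1), where p = 0])
      fix i assume i: "i \<le> ?n"
      show "\<bar>int (h i) - int i\<bar> \<le> int ?R" using h_diff[OF i] by simp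
      show "inv (val (take i w)) \<otimes> val (take (h i) v) \<in> ball ?R"
        using h_near[OF i] by (rule ball_mono) simp
    qed (use h_le h_mono in \<open>auto simp: h_def\<close>)
    then have "(\<one>, int ?m - int ?n, False) \<in> foldl (step ?R) start w"
      using wl v(2) h_n by simp
    moreover have "int ?m - int ?n < 0" using 1 by simp
    ultimately show ?thesis unfolding beaten_def by blast
  next
    case 2
    let ?p = "length c"
    \<comment> \<open>Keeping \<open>v\<close> ahead of the branch point lets the tracking start there.\<close>
    define e where "e i = max (h i) (Suc ?p)" for i
    \<comment> \<open>If the maximum raises \<open>h i\<close>, the new value \<open>Suc ?p\<close>
      is still at most \<open>i\<close>, so it only moves closer to \<open>i\<close>.\<close>
    have e_diff: "\<bar>int (e i) - int i\<bar> \<le> int K + 2" if "Suc ?p \<le> i" "i \<le> ?n" for i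
      using h_diff[OF that(2)] that by (auto simp: e_def)
    have e_near: "inv (val (take i w)) \<otimes> val (take (e i) v) \<in> ball ?R"
      if i: "Suc ?p \<le> i" "i \<le> ?n" for i
    proof (cases "Suc ?p \<le> h i")
      case True
      then show ?thesis using h_near[OF i(2)] by (auto simp: e_def max_absorb1 intro: ball_mono)
    next
      \<comment> \<open>Here \<open>v\<close> is cut off just after \<open>t\<close>. From the
        vertex of \<open>w\<close> at \<open>i\<close> one goes back along \<open>w\<close> to
        \<open>c\<close> and then follows \<open>t\<close>, for a length of
        \<open>i - ?p + 1\<close>; as \<open>h i \<le> ?p\<close>, this is at most
        \<open>K + 3\<close>.\<close>
      case False
      have c: "c \<in> lists A" "t \<in> A" using v(1) 2 by auto
      have "inv (inv (val (take ?p w)) \<otimes> val (take i w)) \<in> ball (i - ?p)"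
        using i by (intro ball_inv inv_take_in_ball wl) auto
      then have "inv (val (take i w)) \<otimes> val c \<in> ball (i - ?p)"
        using c wl by (simp add: 2(2)[symmetric] inv_mult_group) (simp add: 2(2))
      moreover have "val [t] \<in> ball 1" using c by (intro val_in_ball) auto
      ultimately have "inv (val (take i w)) \<otimes> val c \<otimes> val [t] \<in> ball (i - ?p + 1)"
        by (rule ball_mult)
      moreover have "take (e i) v = c @ [t]" using False 2 by (simp add: e_def max_absorb2)
      moreover have "i - ?p + 1 \<le> ?R" using False h_diff[OF i(2)] by linarith
      ultimately show ?thesis using c wl by (auto simp: val_append m_assoc intro: ball_mono)
    qed
    have p: "Suc ?p \<le> ?n" using 2 by simp
    have "(inv (val (take ?n w)) \<otimes> val (take (e ?n) v), int (e ?n) - int ?n, True)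
        \<in> foldl (step ?R) start (take ?n w)"
    proof (rule step_track[OF wl v(1), where p = "Suc ?p"])
      fix i assume i: "Suc ?p \<le> i"
      show "e i \<le> ?m" if "i \<le> ?n" using h_le[OF that] 2 by (simp add: e_def)
      show "e i \<le> e (Suc i)" if "i < ?n" using h_mono[OF that] by (simp add: e_def)
      show "\<bar>int (e i) - int i\<bar> \<le> int ?R" if "i \<le> ?n" using e_diff[OF i that] by simp
    next
      \<comment> \<open>The branching block is all that \<open>v\<close> reads from the branch point
        up to \<open>e (Suc ?p)\<close>. It contains \<open>t\<close> because
        \<open>e (Suc ?p)\<close> is at least \<open>Suc ?p\<close>.\<close>
      let ?b = "drop ?p (take (e (Suc ?p)) v)"
      have c: "c \<in> lists A" "s \<in> A" using wl 2 by auto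
      have b: "?b \<in> lists A" "hd ?b = t" "?b \<noteq> []" using v(1) 2 by (auto simp: e_def)
      have len_b: "length ?b = e (Suc ?p) - ?p"
        using h_le[OF p] 2 by (simp add: e_def)
      have "val (take (e (Suc ?p)) v) = val c \<otimes> val ?b"
        using val_take_split[OF v(1), of ?p "e (Suc ?p)"] 2 by (simp add: e_def)
      then have g: "inv (val (take (Suc ?p) w)) \<otimes> val (take (e (Suc ?p)) v) = inv s \<otimes> val ?b"
        using c b(1) by (simp add: 2(2) val_append val_Cons inv_mult_group m_assoc)
      have k: "int (e (Suc ?p)) - int (Suc ?p) = int (length ?b) - 1"
        unfolding len_b by (simp add: e_def)
      have bw: "?b \<in> words (2 * ?R + 1)"
        using len_b b(1) e_diff[OF order_refl p] by (simp add: words_def)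
      have tok: "(inv (val (take (Suc ?p) w)) \<otimes> val (take (e (Suc ?p)) v),
          int (e (Suc ?p)) - int (Suc ?p), True) \<in> tokens ?R"
        using e_near[OF order_refl p] e_diff[OF order_refl p] by (auto simp: tokens_def)
      have "(inv (val (take (Suc ?p) w)) \<otimes> val (take (e (Suc ?p)) v),
          int (e (Suc ?p)) - int (Suc ?p), True) \<in> step ?R (foldl (step ?R) start c) s"
        by (rule step_branchI[OF bw b(3) _ tok g k]) (simp only: b(2) 2(4))
      moreover have "take (Suc ?p) w = c @ [s]" using 2 by simp
      ultimately show "(inv (val (take (Suc ?p) w)) \<otimes> val (take (e (Suc ?p)) v),
          int (e (Suc ?p)) - int (Suc ?p), True) \<in> foldl (step ?R) start (take (Suc ?p) w)"
        by simp
    qed (use p e_near in auto)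
    moreover have "e ?n = ?m" using h_n 2 by (simp add: e_def)
    ultimately show ?thesis using 2(1) wl v(2) by (auto simp: beaten_def)
  qed
qed

section \<open>From fellow travelling to regularity\<close>

text \<open>Distances are integers, so the real constant may be rounded down. The resulting
  \<open>R\<close> is the same for all words, so a single automaton serves them all.\<close>

lemma fftp_step_complete:
  assumes "SL_FFTP G S r"
  obtains R where "\<And>w a. reduced w \<Longrightarrow> a \<in> A \<Longrightarrow> \<not> reduced (w @ [a]) \<Longrightarrow>
    beaten (foldl (step R) start (w @ [a]))"
proof -
  obtain K where K: "K \<ge> 0" "\<And>w. w \<in> lists A \<Longrightarrow> \<not> reduced w \<Longrightarrow>
      \<exists>v \<in> lists A. async_fellow_travel G S K w v \<and> val w = val v \<and> (v, w) \<in> lenlex r"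
    using assms unfolding SL_FFTP_def SL_set_eq by auto
  have "beaten (foldl (step (nat \<lfloor>K\<rfloor> + 3)) start (w @ [a]))"
    if wa: "reduced w" "a \<in> A" "\<not> reduced (w @ [a])" for w a
  proof -
    let ?w = "w @ [a]"
    have w: "?w \<in> lists A" using wa by (simp add: reduced_def)
    obtain v where v: "v \<in> lists A" "async_fellow_travel G S K ?w v" "val v = val ?w"
        "(v, ?w) \<in> lenlex r"
      using K(2)[OF w wa(3)] by metis
    obtain f where f: "f \<in> {0..length ?w} \<rightarrow> {0..length v}" "mono_on {0..length ?w} f"
      "\<And>i. i \<in> {0..length ?w} \<Longrightarrow>
        real (cayley_dist G S (val (take i ?w)) (val (take (f i) v))) \<le> K"
      using v(2) unfolding async_fellow_travel_def async_fellow_travel_paths_def word_path_def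
      by blast
    show ?thesis
    proof (rule step_complete[OF wa(1,2) refl v(1,3,4)])
      fix i assume i: "i \<le> length ?w"
      show "f i \<le> length v" using f(1) i by auto
      have "cayley_dist G S (val (take i ?w)) (val (take (f i) v)) \<le> nat \<lfloor>K\<rfloor>"
        using f(3)[of i] i by (simp add: le_nat_floor)
      then show "inv (val (take i ?w)) \<otimes> val (take (f i) v) \<in> ball (nat \<lfloor>K\<rfloor>)"
        using w v(1) by (intro cayley_dist_ball val_closed take_lists)
    next
      fix i j assume "i \<le> j" "j \<le> length ?w"
      then show "f i \<le> f j" using f(2) by (auto intro: mono_onD)
    qed
  qed
  then show ?thesis by (rule that)
qed

theorem regular_SL_set:
  assumes "SL_FFTP G S r"
  shows "regular_language A (SL_set G S r)"
proof -
  obtain R where R: "\<And>w a. reduced w \<Longrightarrow> a \<in> A \<Longrightarrow> \<not> reduced (w @ [a]) \<Longrightarrow>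
      beaten (foldl (step R) start (w @ [a]))"
    using fftp_step_complete[OF assms] by blast
  let ?Q = "Pow (tokens R)"
  have run: "(reduced w \<longrightarrow> foldl (sticky_step R) start w = foldl (step R) start w) \<and>
      (beaten (foldl (sticky_step R) start w) \<longleftrightarrow> \<not> reduced w)" if "w \<in> lists A" for w
    using that
  proof (induction w rule: rev_induct)
    case Nil
    show ?case by (auto simp: beaten_def reduced_def)
  next
    case (snoc a w)
    then have w: "w \<in> lists A" "a \<in> A" by auto
    show ?case
    proof (cases "reduced w")
      case True
      then have "foldl (sticky_step R) start w = foldl (step R) start w"
        "\<not> beaten (foldl (sticky_step R) start w)"
        using snoc.IH[OF w(1)] by auto
      then have "foldl (sticky_step R) start (w @ [a]) = foldl (step R) start (w @ [a])"
        unfolding foldl_append by (simp add: sticky_step_def[of R "foldl (step R) start w"])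
      then show ?thesis using R[OF True w(2)] beaten_not_reduced[OF snoc.prems] by auto
    next
      case False
      then show ?thesis using snoc.IH[OF w(1)] reduced_prefix[of w "[a]"]
        by (auto simp: sticky_step_def[of R "foldl (sticky_step R) start w"])
    qed
  qed
  have in_Q: "foldl (sticky_step R) start w \<in> ?Q" if "w \<in> lists A" for w
    using that is_dfa_tokens[of R] by (induction w rule: rev_induct) (auto simp: is_dfa_def)
  have "SL_set G S r = dfa_language A (sticky_step R) start {X \<in> ?Q. \<not> beaten X}"
  proof (rule Set.set_eqI)
    fix w
    have "reduced w \<Longrightarrow> w \<in> lists A" by (simp add: reduced_def)
    then show "w \<in> SL_set G S r \<longleftrightarrow>
        w \<in> dfa_language A (sticky_step R) start {X \<in> ?Q. \<not> beaten X}"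
      using run[of w] in_Q[of w] unfolding SL_set_eq dfa_language_def by blast
  qed
  then show ?thesis using regular_languageI[OF is_dfa_tokens[of R]] by simp
qed

end

theorem theorem1:
  fixes G :: "('a, 'b) monoid_scheme" and S :: "'a set" and r :: "('a \<times> 'a) set"
  assumes "group G"
    and "finite S" and "S \<subseteq> carrier G" and "generate G S = carrier G"
    and "r \<subseteq> letters G S \<times> letters G S" and "strict_linear_order_on (letters G S) r"
    and "SL_FFTP G S r"
  shows "regular_language (letters G S) (SL_set G S r)"
proof -
  interpret group G by fact
  interpret shortlex_group G S r
    using assms(2-6) by (intro shortlex_group.intro shortlex_group_axioms.intro is_group)
  show ?thesis using assms(7) by (rule regular_SL_set)
qed

end
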